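(* Let $(A,\circ_A,[\cdot,\cdot]_A)$ be a Gel'fand-Dorfman algebra, and suppose that there is a Gel'fand-Dorfman algebra structure $(A^\ast,\circ_{A^\ast},[\cdot,\cdot]_{A^\ast})$ on $A^\ast$. Then there is a Manin triple $(A\oplus A^\ast,(A,\circ_A,[\cdot,\cdot]_A),(A^\ast,\circ_{A^\ast},[\cdot,\cdot]_{A^\ast}))$ of Gel'fand-Dorfman algebras if and only if $$(A,A^\ast,L_{\star_A}^\ast,-R_{\circ_A}^\ast,\mathrm{ad}_A^\ast,L_{\star_{A^\ast}}^\ast,-R_{\circ_{A^\ast}}^\ast,\mathrm{ad}_{A^\ast}^\ast)$$ is a matched pair of Gel'fand-Dorfman algebras.
   Context: Conventions: $\mathbf{k}$ is a field of characteristic $0$; vector spaces over $\mathbf{k}$ are finite-dimensional (and $A^{\ast\ast}=A$). $L_\circ(a)b=a\circ b$, $R_\circ(a)b=b\circ a$, $a\star b=a\circ b+b\circ a$, $L_\star(a)b=a\star b$, $\mathrm{ad}(a)b=[a,b]$; subscripts $A$, $A^\ast$ indicate the algebra. For $\varphi:A\to\mathrm{End}_{\mathbf{k}}(V)$ linear, $\varphi^\ast:A\to\mathrm{End}_{\mathbf{k}}(V^\ast)$ is $\langle\varphi^\ast(a)f,u\rangle=-\langle f,\varphi(a)u\rangle$. A Novikov algebra $(A,\circ)$ satisfies $(a\circ b)\circ c-a\circ(b\circ c)=(b\circ a)\circ c-b\circ(a\circ c)$ and $(a\circ b)\circ c=(a\circ c)\circ b$. A Gel'fand-Dorfman (GD)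 algebra $(A,\circ,[\cdot,\cdot])$ is a Novikov algebra $(A,\circ)$ and a Lie algebra $(A,[\cdot,\cdot])$ with $[a\circ b,c]-[a\circ c,b]+[a,b]\circ c-[a,c]\circ b-a\circ[b,c]=0$ for all $a,b,c$. Matched pair: for GD algebras $A,B$ and linear maps $l_A,r_A,\rho_A:A\to\mathrm{End}_{\mathbf{k}}(B)$, $l_B,r_B,\rho_B:B\to\mathrm{End}_{\mathbf{k}}(A)$, the octuple $(A,B,l_A,r_A,\rho_A,l_B,r_B,\rho_B)$ is a matched pair of GD algebras if $A\oplus B$ is a GD algebra under $(a+x)\bullet(b+y)=(a\circ_A b+l_B(x)b+r_B(y)a)+(x\circ_B y+l_A(a)y+r_A(b)x)$, $[a+x,b+y]=([a,b]_A+\rho_B(x)b-\rho_B(y)a)+([x,y]_B+\rho_A(a)y-\rho_A(b)x)$, for $a,b\in A$, $x,y\in B$. Manin triple: a (standard) Manin triple of GD algebras is a triple $(A\oplus A^\ast,(A,\circ_A,[\cdot,\cdot]_A),(A^\ast,\circ_{A^\ast},[\cdot,\cdot]_{A^\ast}))$ of GD algebras where $A\oplus A^\ast$ (vector space direct sum) carries a GD algebra structure $(\circ,[\cdot,\cdot])$ containing $A$ and $A^\ast$ as GD subalgebras, such that the bilinear form $(a+f,b+g)=\langle f,b\rangle+\langle g,a\rangle$ ($a,b\in A$, $f,g\in A^\ast$) is invariant, i.e. $(x\circ y,z)=-(y,x\star z)$ and $([x,y],z)=(x,[y,z])$ for all $x,y,z\in A\oplus A^\ast$. *)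

theory Defs
  imports "HOL-Analysis.Product_Vector" "HOL-Library.Function_Algebras"
begin

text \<open>
  Algebras live on a subspace \<open>V\<close> of an ambient vector space, and only the values of the operations
  on \<open>V\<close> matter. This is needed because the dual space is a proper subset of a function type.
\<close>

definition linear_on ::
  "('k::field \<Rightarrow> 'u::ab_group_add \<Rightarrow> 'u) \<Rightarrow> 'u set \<Rightarrow> ('k \<Rightarrow> 'v::ab_group_add \<Rightarrow> 'v) \<Rightarrow> 'v set \<Rightarrow>
   ('u \<Rightarrow> 'v) \<Rightarrow> bool"
  where "linear_on s U t V f \<longleftrightarrow>
    (\<forall>x\<in>U. f x \<in> V) \<and>
    (\<forall>x\<in>U. \<forall>y\<in>U. f (x + y) = f x + f y) \<and>
    (\<forall>c. \<forall>x\<in>U. f (s c x) = t c (f x))"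

text \<open>A linear map \<open>\<phi> : U \<rightarrow> End(V)\<close>, i.e. a bilinear map \<open>U \<times> V \<rightarrow> V\<close>.\<close>

definition linear_to_End ::
  "('k::field \<Rightarrow> 'u::ab_group_add \<Rightarrow> 'u) \<Rightarrow> 'u set \<Rightarrow> ('k \<Rightarrow> 'v::ab_group_add \<Rightarrow> 'v) \<Rightarrow> 'v set \<Rightarrow>
   ('u \<Rightarrow> 'v \<Rightarrow> 'v) \<Rightarrow> bool"
  where "linear_to_End s U t V \<phi> \<longleftrightarrow>
    (\<forall>a\<in>U. linear_on t V t V (\<phi> a)) \<and> (\<forall>v\<in>V. linear_on s U t V (\<lambda>a. \<phi> a v))"

locale novikov_algebra = vector_space scale
  for scale :: "'k::field_char_0 \<Rightarrow> 'v::ab_group_add \<Rightarrow> 'v" +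
  fixes V :: "'v set" and mul :: "'v \<Rightarrow> 'v \<Rightarrow> 'v"
  assumes subspace_V: "subspace V"
    and mul_bilinear: "linear_to_End scale V scale V mul"
    and left_symmetric: "\<lbrakk>a \<in> V; b \<in> V; c \<in> V\<rbrakk> \<Longrightarrow>
      mul (mul a b) c - mul a (mul b c) = mul (mul b a) c - mul b (mul a c)"
    and right_commutative: "\<lbrakk>a \<in> V; b \<in> V; c \<in> V\<rbrakk> \<Longrightarrow> mul (mul a b) c = mul (mul a c) b"

locale lie_algebra = vector_space scale
  for scale :: "'k::field_char_0 \<Rightarrow> 'v::ab_group_add \<Rightarrow> 'v" +
  fixes V :: "'v set" and br :: "'v \<Rightarrow> 'v \<Rightarrow> 'v"
  assumes lie_subspace_V: "subspace V"
    and br_bilinear: "linear_to_End scale V scale V br"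
    and br_self: "a \<in> V \<Longrightarrow> br a a = 0"
    and jacobi: "\<lbrakk>a \<in> V; b \<in> V; c \<in> V\<rbrakk> \<Longrightarrow> br a (br b c) + br b (br c a) + br c (br a b) = 0"

locale GD_algebra = novikov_algebra scale V mul + lie_algebra scale V br
  for scale :: "'k::field_char_0 \<Rightarrow> 'v::ab_group_add \<Rightarrow> 'v"
    and V :: "'v set" and mul br :: "'v \<Rightarrow> 'v \<Rightarrow> 'v" +
  assumes GD_compat: "\<lbrakk>a \<in> V; b \<in> V; c \<in> V\<rbrakk> \<Longrightarrow>
    br (mul a b) c - br (mul a c) b + mul (br a b) c - mul (br a c) b - mul a (br b c) = 0"

definition right_mult :: "('v \<Rightarrow> 'v \<Rightarrow> 'v) \<Rightarrow> 'v \<Rightarrow> 'v \<Rightarrow> 'v"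
  where "right_mult mul a b = mul b a"

definition star :: "('v \<Rightarrow> 'v \<Rightarrow> 'v::plus) \<Rightarrow> 'v \<Rightarrow> 'v \<Rightarrow> 'v"
  where "star mul a b = mul a b + mul b a"

definition left_star :: "('v \<Rightarrow> 'v \<Rightarrow> 'v::plus) \<Rightarrow> 'v \<Rightarrow> 'v \<Rightarrow> 'v"
  where "left_star mul a b = star mul a b"

definition ad :: "('v \<Rightarrow> 'v \<Rightarrow> 'v) \<Rightarrow> 'v \<Rightarrow> 'v \<Rightarrow> 'v"
  where "ad br a b = br a b"

text \<open>The dual space: the linear functionals, inside the vector space of all functions.\<close>

definition dual_scale :: "'k::field \<Rightarrow> ('v \<Rightarrow> 'k) \<Rightarrow> ('v \<Rightarrow> 'k)"
  where "dual_scale c f = (\<lambda>u. c * f u)"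

definition dual :: "('k::field \<Rightarrow> 'v::ab_group_add \<Rightarrow> 'v) \<Rightarrow> ('v \<Rightarrow> 'k) set"
  where "dual s = {f. Vector_Spaces.linear s (*) f}"

text \<open>\<open>\<phi>\<^sup>* : A \<rightarrow> End(V\<^sup>*)\<close> for \<open>\<phi> : A \<rightarrow> End(V)\<close>.\<close>

definition dual_rep :: "('a \<Rightarrow> 'v \<Rightarrow> 'v) \<Rightarrow> 'a \<Rightarrow> ('v \<Rightarrow> 'k::field) \<Rightarrow> ('v \<Rightarrow> 'k)"
  where "dual_rep \<phi> a f = (\<lambda>u. - f (\<phi> a u))"

text \<open>
  The identification \<open>A\<^sup>*\<^sup>* = A\<close>: \<open>to_bidual a\<close> is evaluation at \<open>a\<close>, and \<open>from_bidual\<close> is its inverse.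
  Elements of the bidual are compared on \<open>dual s\<close> only. If \<open>\<phi>\<close> maps \<open>X\<close> to \<open>End(A\<^sup>*)\<close>, then
  \<open>predual_rep s \<phi>\<close> is the representation \<open>\<phi>\<^sup>*\<close> on \<open>A\<^sup>*\<^sup>*\<close>, transported to \<open>A\<close>.
\<close>

definition to_bidual :: "'v \<Rightarrow> ('v \<Rightarrow> 'k) \<Rightarrow> 'k"
  where "to_bidual a = (\<lambda>f. f a)"

definition from_bidual ::
  "('k::field \<Rightarrow> 'v::ab_group_add \<Rightarrow> 'v) \<Rightarrow> (('v \<Rightarrow> 'k) \<Rightarrow> 'k) \<Rightarrow> 'v"
  where "from_bidual s F = (THE a. \<forall>f\<in>dual s. to_bidual a f = F f)"

definition predual_rep ::
  "('k::field \<Rightarrow> 'v::ab_group_add \<Rightarrow> 'v) \<Rightarrow> ('x \<Rightarrow> ('v \<Rightarrow> 'k) \<Rightarrow> ('v \<Rightarrow> 'k)) \<Rightarrow> 'x \<Rightarrow> 'v \<Rightarrow> 'v"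
  where "predual_rep s \<phi> x a = from_bidual s (dual_rep \<phi> x (to_bidual a))"

text \<open>
  The eight entries of the octuple are \<open>(A, B, l\<^sub>A, r\<^sub>A, \<rho>\<^sub>A, l\<^sub>B, r\<^sub>B, \<rho>\<^sub>B)\<close>; the algebra \<open>A\<close> is given by
  \<open>sA A mA bA\<close> (scalar multiplication, carrier, Novikov product, bracket), and similarly \<open>B\<close>.
\<close>

definition GD_matched_pair ::
  "('k::field_char_0 \<Rightarrow> 'a::ab_group_add \<Rightarrow> 'a) \<Rightarrow> 'a set \<Rightarrow> ('a \<Rightarrow> 'a \<Rightarrow> 'a) \<Rightarrow> ('a \<Rightarrow> 'a \<Rightarrow> 'a) \<Rightarrow>
   ('k \<Rightarrow> 'b::ab_group_add \<Rightarrow> 'b) \<Rightarrow> 'b set \<Rightarrow> ('b \<Rightarrow> 'b \<Rightarrow> 'b) \<Rightarrow> ('b \<Rightarrow> 'b \<Rightarrow> 'b) \<Rightarrow>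
   ('a \<Rightarrow> 'b \<Rightarrow> 'b) \<Rightarrow> ('a \<Rightarrow> 'b \<Rightarrow> 'b) \<Rightarrow> ('a \<Rightarrow> 'b \<Rightarrow> 'b) \<Rightarrow>
   ('b \<Rightarrow> 'a \<Rightarrow> 'a) \<Rightarrow> ('b \<Rightarrow> 'a \<Rightarrow> 'a) \<Rightarrow> ('b \<Rightarrow> 'a \<Rightarrow> 'a) \<Rightarrow> bool"
  where "GD_matched_pair sA A mA bA sB B mB bB lA rA \<rho>A lB rB \<rho>B \<longleftrightarrow>
    GD_algebra sA A mA bA \<and> GD_algebra sB B mB bB \<and>
    linear_to_End sA A sB B lA \<and> linear_to_End sA A sB B rA \<and> linear_to_End sA A sB B \<rho>A \<and>
    linear_to_End sB B sA A lB \<and> linear_to_End sB B sA A rB \<and> linear_to_End sB B sA A \<rho>B \<and>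
    GD_algebra (module_prod.scale sA sB) (A \<times> B)
      (\<lambda>(a, x) (b, y). (mA a b + lB x b + rB y a, mB x y + lA a y + rA b x))
      (\<lambda>(a, x) (b, y). (bA a b + \<rho>B x b - \<rho>B y a, bB x y + \<rho>A a y - \<rho>A b x))"

definition manin_form :: "'a \<times> ('a \<Rightarrow> 'k::field) \<Rightarrow> 'a \<times> ('a \<Rightarrow> 'k) \<Rightarrow> 'k"
  where "manin_form p q = snd p (fst q) + snd q (fst p)"

text \<open>
  \<open>GD_Manin_triple s mA bA mD bD m b\<close>: the structure \<open>(m, b)\<close> on \<open>A \<oplus> A\<^sup>*\<close> makes
  \<open>(A \<oplus> A\<^sup>*, (A, mA, bA), (A\<^sup>*, mD, bD))\<close> a Manin triple, where \<open>A\<close> is the whole type.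
\<close>

definition GD_Manin_triple ::
  "('k::field_char_0 \<Rightarrow> 'a::ab_group_add \<Rightarrow> 'a) \<Rightarrow> ('a \<Rightarrow> 'a \<Rightarrow> 'a) \<Rightarrow> ('a \<Rightarrow> 'a \<Rightarrow> 'a) \<Rightarrow>
   (('a \<Rightarrow> 'k) \<Rightarrow> ('a \<Rightarrow> 'k) \<Rightarrow> ('a \<Rightarrow> 'k)) \<Rightarrow> (('a \<Rightarrow> 'k) \<Rightarrow> ('a \<Rightarrow> 'k) \<Rightarrow> ('a \<Rightarrow> 'k)) \<Rightarrow>
   ('a \<times> ('a \<Rightarrow> 'k) \<Rightarrow> 'a \<times> ('a \<Rightarrow> 'k) \<Rightarrow> 'a \<times> ('a \<Rightarrow> 'k)) \<Rightarrow>
   ('a \<times> ('a \<Rightarrow> 'k) \<Rightarrow> 'a \<times> ('a \<Rightarrow> 'k) \<Rightarrow> 'a \<times> ('a \<Rightarrow> 'k)) \<Rightarrow> bool"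
  where "GD_Manin_triple s mA bA mD bD m b \<longleftrightarrow>
    GD_algebra s UNIV mA bA \<and>
    GD_algebra dual_scale (dual s) mD bD \<and>
    GD_algebra (module_prod.scale s dual_scale) (UNIV \<times> dual s) m b \<and>
    (\<forall>x y. m (x, 0) (y, 0) = (mA x y, 0) \<and> b (x, 0) (y, 0) = (bA x y, 0)) \<and>
    (\<forall>f\<in>dual s. \<forall>g\<in>dual s. m (0, f) (0, g) = (0, mD f g) \<and> b (0, f) (0, g) = (0, bD f g)) \<and>
    (\<forall>x\<in>UNIV \<times> dual s. \<forall>y\<in>UNIV \<times> dual s. \<forall>z\<in>UNIV \<times> dual s.
      manin_form (m x y) z = - manin_form y (star m x z) \<and>
      manin_form (b x y) z = manin_form x (b y z))"

end

theory Submission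
  imports Defs
begin

text \<open>
  The idea: invariance of the form leaves no freedom for the mixed products of \<open>A \<oplus> A\<^sup>*\<close>. For
  \<open>a \<in> A\<close> and \<open>g \<in> A\<^sup>*\<close>, testing \<open>(a \<circ> g, z) = - (g, a \<star> z)\<close> against \<open>z \<in> A\<close> involves only the
  product of \<open>A\<close>; testing against \<open>z \<in> A\<^sup>*\<close>, and using that \<open>\<star>\<close> is commutative to rewrite
  \<open>(a \<circ> g, z) = (z \<circ> g, a)\<close>, involves only the product of \<open>A\<^sup>*\<close>. As the form is nondegenerate,
  \<open>a \<circ> g\<close> is determined by the two given algebras, and reading off the two tests gives exactly
  \<open>L\<^sub>\<star>\<^sup>*(a) g\<close> and \<open>- R\<^sub>\<circ>\<^sup>*(g) a\<close>. The products \<open>g \<circ> a\<close> are the same case with \<open>A\<close> and \<open>A\<^sup>*\<close>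
  exchanged, and for brackets antisymmetry plays the part of the commutativity of \<open>\<star>\<close> (lemmas
  \<open>manin_triple_mul_unique\<close> and \<open>manin_triple_br_unique\<close>). So the only candidate for a Manin
  triple is the algebra of the matched pair built from the dual representations, and a Manin
  triple makes that candidate a GD algebra.

  Conversely, the product and bracket of that candidate always satisfy the invariance identities,
  whether or not they form a GD algebra: expanded in the operations of \<open>A\<close> and \<open>A\<^sup>*\<close>, and using
  antisymmetry in the case of brackets, the two sides have the same terms (lemmas
  \<open>double_mul_invariant\<close> and \<open>double_br_invariant\<close>). So if the candidate is a GD algebra, it is a Manin triple.

  Finite dimension enters through \<open>A\<^sup>*\<^sup>* = A\<close>, which makes the representations on \<open>A\<close> dual to those
  on \<open>A\<^sup>*\<close> well defined (lemma \<open>predual_rep_pairing\<close>).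
\<close>

section \<open>Bilinear maps on subspaces\<close>

lemma linear_to_EndI:
  assumes "\<And>a v. \<lbrakk>a \<in> U; v \<in> V\<rbrakk> \<Longrightarrow> \<phi> a v \<in> V"
    and "\<And>a b v. \<lbrakk>a \<in> U; b \<in> U; v \<in> V\<rbrakk> \<Longrightarrow> \<phi> (a + b) v = \<phi> a v + \<phi> b v"
    and "\<And>a v w. \<lbrakk>a \<in> U; v \<in> V; w \<in> V\<rbrakk> \<Longrightarrow> \<phi> a (v + w) = \<phi> a v + \<phi> a w"
    and "\<And>c a v. \<lbrakk>a \<in> U; v \<in> V\<rbrakk> \<Longrightarrow> \<phi> (s c a) v = t c (\<phi> a v)"
    and "\<And>c a v. \<lbrakk>a \<in> U; v \<in> V\<rbrakk> \<Longrightarrow> \<phi> a (t c v) = t c (\<phi> a v)"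
  shows "linear_to_End s U t V \<phi>"
  using assms unfolding linear_to_End_def linear_on_def by blast

lemma linear_to_EndD:
  assumes "linear_to_End s U t V \<phi>"
  shows "\<And>a v. \<lbrakk>a \<in> U; v \<in> V\<rbrakk> \<Longrightarrow> \<phi> a v \<in> V"
    and "\<And>a b v. \<lbrakk>a \<in> U; b \<in> U; v \<in> V\<rbrakk> \<Longrightarrow> \<phi> (a + b) v = \<phi> a v + \<phi> b v"
    and "\<And>a v w. \<lbrakk>a \<in> U; v \<in> V; w \<in> V\<rbrakk> \<Longrightarrow> \<phi> a (v + w) = \<phi> a v + \<phi> a w"
    and "\<And>c a v. \<lbrakk>a \<in> U; v \<in> V\<rbrakk> \<Longrightarrow> \<phi> (s c a) v = t c (\<phi> a v)"
    and "\<And>c a v. \<lbrakk>a \<in> U; v \<in> V\<rbrakk> \<Longrightarrow> \<phi> a (t c v) = t c (\<phi> a v)"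
  using assms unfolding linear_to_End_def linear_on_def by blast+

lemma (in vector_space) linear_to_End_minus:
  assumes "linear_to_End s U scale V \<phi>" and "subspace V"
  shows "linear_to_End s U scale V (\<lambda>a v. - \<phi> a v)"
  using linear_to_EndD[OF assms(1)] subspace_neg[OF assms(2)]
  by (intro linear_to_EndI) auto

lemma linear_to_End_right_mult:
  assumes "linear_to_End s U s U mul"
  shows "linear_to_End s U s U (right_mult mul)"
  using linear_to_EndD[OF assms] by (intro linear_to_EndI) (auto simp: right_mult_def)

lemma (in vector_space) linear_to_End_left_star:
  assumes "linear_to_End scale U scale U mul" and "subspace U"
  shows "linear_to_End scale U scale U (left_star mul)"
  using linear_to_EndD[OF assms(1)] subspace_add[OF assms(2)]
  by (intro linear_to_EndI) (auto simp: left_star_def star_def scale_right_distrib algebra_simps)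

lemma linear_to_End_ad:
  assumes "linear_to_End s U s U br"
  shows "linear_to_End s U s U (ad br)"
  using linear_to_EndD[OF assms] by (intro linear_to_EndI) (auto simp: ad_def)

lemma (in vector_space) linear_to_End_zero:
  assumes "linear_to_End scale U scale U mul" and "a \<in> U"
  shows "mul 0 a = 0" and "mul a 0 = 0"
  using linear_to_EndD(4,5)[OF assms(1) assms(2) assms(2), of 0] by simp_all

lemmas (in novikov_algebra) mul_zero = linear_to_End_zero[OF mul_bilinear]

lemmas (in lie_algebra) br_zero = linear_to_End_zero[OF br_bilinear]

lemma (in lie_algebra) br_antisym:
  assumes "a \<in> V" "b \<in> V"
  shows "br b a = - br a b"
proof -
  note D = linear_to_EndD[OF br_bilinear]
  have ab: "a + b \<in> V"
    using assms subspace_add[OF lie_subspace_V] by blast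
  have "br (a + b) (a + b) = (br a a + br b a) + (br a b + br b b)"
    using assms ab by (simp only: D)
  then have "br a b + br b a = 0"
    using assms ab by (simp add: br_self add.commute)
  then show ?thesis
    by (metis minus_unique)
qed

text \<open>
  An algebra on a carrier does not see the values of its operations off the carrier. The uniqueness
  lemmas below identify operations only on the carrier \<open>A \<oplus> A\<^sup>*\<close>, so this is what transports the
  GD structure.
\<close>

lemma GD_algebra_cong:
  assumes "GD_algebra s V mul br"
    and mul: "\<And>x y. \<lbrakk>x \<in> V; y \<in> V\<rbrakk> \<Longrightarrow> mul' x y = mul x y"
    and br: "\<And>x y. \<lbrakk>x \<in> V; y \<in> V\<rbrakk> \<Longrightarrow> br' x y = br x y"
  shows "GD_algebra s V mul' br'"
proof -
  interpret GD_algebra s V mul br by fact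
  note M = linear_to_EndD[OF mul_bilinear]
  note B = linear_to_EndD[OF br_bilinear]
  have sub: "x + y \<in> V" "s c x \<in> V" if "x \<in> V" "y \<in> V" for c x y
    using that subspace_add[OF subspace_V] subspace_scale[OF subspace_V] by auto
  show ?thesis
  proof unfold_locales
    show "linear_to_End s V s V mul'" "linear_to_End s V s V br'"
      by (intro linear_to_EndI; simp add: mul br M B sub)+
  qed (simp_all add: mul br M(1) B(1) subspace_V left_symmetric right_commutative br_self jacobi
      GD_compat)
qed

section \<open>The dual space\<close>

context vector_space
begin

lemma dual_iff:
  "f \<in> dual scale \<longleftrightarrow>
    (\<forall>x y. f (x + y) = f x + f y) \<and> (\<forall>c x. f (scale c x) = c * f x)"
proof -
  have "vector_space ((*) :: 'a \<Rightarrow> 'a \<Rightarrow> 'a)"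
    by unfold_locales (auto simp: algebra_simps)
  then show ?thesis
    using vector_space_axioms by (simp add: dual_def Vector_Spaces.linear_iff)
qed

lemma dual_add: "f \<in> dual scale \<Longrightarrow> f (x + y) = f x + f y"
  and dual_scaled: "f \<in> dual scale \<Longrightarrow> f (scale c x) = c * f x"
  by (simp_all add: dual_iff)

lemma dual_zero: "f \<in> dual scale \<Longrightarrow> f 0 = 0"
  using dual_scaled[of f 0 0] by simp

lemma dual_minus: "f \<in> dual scale \<Longrightarrow> f (- x) = - f x"
  using dual_scaled[of f "-1" x] by simp

lemma dual_diff: "f \<in> dual scale \<Longrightarrow> f (x - y) = f x - f y"
  using dual_add[of f x "- y"] by (simp add: dual_minus)

lemma dual_sum: "f \<in> dual scale \<Longrightarrow> f (sum g I) = (\<Sum>i\<in>I. f (g i))"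
  by (induction I rule: infinite_finite_induct) (simp_all add: dual_zero dual_add)

lemmas dual_linear = dual_add dual_scaled dual_zero dual_minus dual_diff

lemma vector_space_dual_scale: "vector_space (dual_scale :: 'a \<Rightarrow> ('b \<Rightarrow> 'a) \<Rightarrow> _)"
  by unfold_locales (auto simp: dual_scale_def algebra_simps fun_eq_iff)

lemma subspace_dual: "module.subspace dual_scale (dual scale)"
proof -
  interpret D: vector_space "dual_scale :: 'a \<Rightarrow> ('b \<Rightarrow> 'a) \<Rightarrow> _"
    by (rule vector_space_dual_scale)
  show ?thesis
    by (rule D.subspaceI) (auto simp: dual_iff dual_scale_def algebra_simps)
qed

lemma zero_in_dual: "0 \<in> dual scale"
  by (simp add: dual_iff)

lemma linear_to_End_dual_rep:
  assumes "linear_to_End s X scale UNIV \<phi>"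
  shows "linear_to_End s X dual_scale (dual scale) (dual_rep \<phi>)"
  using linear_to_EndD[OF assms]
  by (intro linear_to_EndI)
    (auto simp: dual_iff dual_rep_def dual_scale_def fun_eq_iff)

end

section \<open>Reflexivity\<close>

context finite_dimensional_vector_space
begin

lemma coordinate_in_dual: "(\<lambda>v. representation Basis v b) \<in> dual scale"
  by (simp add: dual_iff representation_add representation_scale independent_Basis span_Basis)

lemma basis_expansion: "(\<Sum>b\<in>Basis. scale (representation Basis v b) b) = v"
  by (rule sum_representation_eq) (auto simp: independent_Basis span_Basis finite_Basis)

lemma dual_separates:
  assumes "\<And>f. f \<in> dual scale \<Longrightarrow> f v = f w"
  shows "v = w"
proof -
  have "representation Basis v b = representation Basis w b" for b
    using assms[OF coordinate_in_dual] .
  then show ?thesis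
    by (metis (no_types, lifting) basis_expansion sum.cong)
qed

text \<open>
  A functional \<open>F\<close> on the dual space is evaluation at the vector whose coordinates are the values
  of \<open>F\<close> on the coordinate functionals.
\<close>

lemma bidual_is_evaluation:
  assumes "linear_on dual_scale (dual scale) (*) UNIV F"
  shows "\<exists>a. \<forall>f\<in>dual scale. F f = f a"
proof (intro exI ballI)
  interpret D: vector_space "dual_scale :: 'a \<Rightarrow> ('b \<Rightarrow> 'a) \<Rightarrow> _"
    by (rule vector_space_dual_scale)
  let ?e = "\<lambda>b v. representation Basis v b"
  have F_add: "F (f + g) = F f + F g" if "f \<in> dual scale" "g \<in> dual scale" for f g
    using assms that by (auto simp: linear_on_def)
  have F_scale: "F (dual_scale c f) = c * F f" if "f \<in> dual scale" for c f
    using assms that by (auto simp: linear_on_def)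
  have scale_mem: "dual_scale c f \<in> dual scale" if "f \<in> dual scale" for c f
    using D.subspace_scale[OF subspace_dual that] .
  have F_zero: "F 0 = 0"
    using F_scale[OF zero_in_dual, of 0] by (simp add: dual_scale_def zero_fun_def)
  have F_sum: "F (\<Sum>b\<in>I. dual_scale (c b) (?e b)) = (\<Sum>b\<in>I. c b * F (?e b))"
    if "finite I" for I c
    using that
  proof (induction I)
    case (insert b I)
    have "(\<Sum>b\<in>I. dual_scale (c b) (?e b)) \<in> dual scale"
      by (intro D.subspace_sum[OF subspace_dual] scale_mem coordinate_in_dual)
    then have "F (dual_scale (c b) (?e b) + (\<Sum>b\<in>I. dual_scale (c b) (?e b))) =
        c b * F (?e b) + F (\<Sum>b\<in>I. dual_scale (c b) (?e b))"
      by (subst F_add) (simp_all add: F_scale scale_mem coordinate_in_dual)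
    then show ?case
      by (simp only: sum.insert[OF insert.hyps] insert.IH)
  qed (simp only: sum.empty F_zero)
  fix f assume f: "f \<in> dual scale"
  have f_apply: "f v = (\<Sum>b\<in>Basis. f b * ?e b v)" for v
  proof -
    have "f v = f (\<Sum>b\<in>Basis. scale (?e b v) b)"
      by (simp add: basis_expansion)
    then show ?thesis
      using f by (simp add: dual_sum dual_scaled mult.commute)
  qed
  have sum_apply: "(\<Sum>b\<in>I. dual_scale (c b) (?e b)) v = (\<Sum>b\<in>I. c b * ?e b v)" for I c v
    by (induction I rule: infinite_finite_induct) (auto simp: dual_scale_def)
  have "f = (\<Sum>b\<in>Basis. dual_scale (f b) (?e b))"
    by (rule ext) (simp add: sum_apply f_apply[symmetric])
  then have "F f = (\<Sum>b\<in>Basis. f b * F (?e b))"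
    using F_sum[OF finite_Basis] by metis
  also have "\<dots> = f (\<Sum>b\<in>Basis. scale (F (?e b)) b)"
    using f by (simp add: dual_sum dual_scaled mult.commute)
  finally show "F f = f (\<Sum>b\<in>Basis. scale (F (?e b)) b)" .
qed

text \<open>
  This is the defining identity of the dual representation under \<open>A\<^sup>*\<^sup>* = A\<close>; every later
  computation with \<open>predual_rep\<close> goes through it.
\<close>

lemma predual_rep_pairing:
  assumes "linear_to_End s X dual_scale (dual scale) \<phi>" and "x \<in> X" and "f \<in> dual scale"
  shows "f (predual_rep scale \<phi> x a) = - \<phi> x f a"
proof -
  let ?F = "dual_rep \<phi> x (to_bidual a)"
  note D = linear_to_EndD[OF assms(1)]
  have "linear_on dual_scale (dual scale) (*) UNIV ?F"
    using assms(2) D by (simp add: linear_on_def dual_rep_def to_bidual_def dual_scale_def)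
  then obtain v where v: "\<And>f. f \<in> dual scale \<Longrightarrow> f v = ?F f"
    by (metis bidual_is_evaluation)
  have "from_bidual scale ?F = v"
    unfolding from_bidual_def
    by (rule the_equality) (auto simp: v to_bidual_def intro: dual_separates)
  then show ?thesis
    using v[OF assms(3)] by (simp add: predual_rep_def dual_rep_def to_bidual_def)
qed

lemma linear_to_End_predual_rep:
  assumes "linear_to_End s X dual_scale (dual scale) \<phi>"
    and "module.subspace s X" and "vector_space s"
  shows "linear_to_End s X scale UNIV (predual_rep scale \<phi>)"
proof -
  interpret S: vector_space s by fact
  note D = linear_to_EndD[OF assms(1)]
  note P = predual_rep_pairing[OF assms(1)]
  have X: "x + y \<in> X" "s c x \<in> X" if "x \<in> X" "y \<in> X" for c x y
    using that S.subspace_add[OF assms(2)] S.subspace_scale[OF assms(2)] by auto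
  show ?thesis
    by (intro linear_to_EndI dual_separates; simp)
      (simp_all add: X P D dual_linear dual_scale_def)
qed

end

section \<open>The operations on the double\<close>

text \<open>
  The operations that the octuple of dual representations puts on \<open>A \<oplus> A\<^sup>*\<close>, spelled as in the
  definition of a matched pair.
\<close>

definition double_mul where
  "double_mul s mA mD = (\<lambda>(a, x) (b, y).
    (mA a b + predual_rep s (left_star mD) x b + - predual_rep s (right_mult mD) y a,
     mD x y + dual_rep (left_star mA) a y + - dual_rep (right_mult mA) b x))"

definition double_br where
  "double_br s bA bD = (\<lambda>(a, x) (b, y).
    (bA a b + predual_rep s (ad bD) x b - predual_rep s (ad bD) y a,
     bD x y + dual_rep (ad bA) a y - dual_rep (ad bA) b x))"

locale dual_GD_pair = finite_dimensional_vector_space scale Basis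
    + A: GD_algebra scale UNIV mA bA
    + D: GD_algebra dual_scale "dual scale" mD bD
  for scale :: "'k::field_char_0 \<Rightarrow> 'a::ab_group_add \<Rightarrow> 'a"
    and Basis :: "'a set"
    and mA bA :: "'a \<Rightarrow> 'a \<Rightarrow> 'a"
    and mD bD :: "('a \<Rightarrow> 'k) \<Rightarrow> ('a \<Rightarrow> 'k) \<Rightarrow> ('a \<Rightarrow> 'k)"
begin

lemma dual_actions:
  shows "linear_to_End scale UNIV dual_scale (dual scale) (dual_rep (left_star mA))"
    and "linear_to_End scale UNIV dual_scale (dual scale) (\<lambda>a f. - dual_rep (right_mult mA) a f)"
    and "linear_to_End scale UNIV dual_scale (dual scale) (dual_rep (ad bA))"
  by (intro linear_to_End_dual_rep linear_to_End_left_star linear_to_End_right_mult linear_to_End_ad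
      D.linear_to_End_minus A.mul_bilinear A.br_bilinear A.subspace_V D.subspace_V)+

lemma dual_multiplications:
  shows "linear_to_End dual_scale (dual scale) dual_scale (dual scale) (left_star mD)"
    and "linear_to_End dual_scale (dual scale) dual_scale (dual scale) (right_mult mD)"
    and "linear_to_End dual_scale (dual scale) dual_scale (dual scale) (ad bD)"
  by (intro D.linear_to_End_left_star linear_to_End_right_mult linear_to_End_ad
      D.mul_bilinear D.br_bilinear D.subspace_V)+

lemma predual_actions:
  shows "linear_to_End dual_scale (dual scale) scale UNIV (predual_rep scale (left_star mD))"
    and "linear_to_End dual_scale (dual scale) scale UNIV
      (\<lambda>f a. - predual_rep scale (right_mult mD) f a)"
    and "linear_to_End dual_scale (dual scale) scale UNIV (predual_rep scale (ad bD))"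
  by (intro linear_to_End_minus linear_to_End_predual_rep dual_multiplications
      D.subspace_V D.vector_space_axioms subspace_UNIV)+

text \<open>
  All six dual representations are linear in both arguments, so being a matched pair is a condition
  on the double alone.
\<close>

lemma matched_pair_iff:
  "GD_matched_pair scale UNIV mA bA dual_scale (dual scale) mD bD
      (dual_rep (left_star mA)) (\<lambda>a f. - dual_rep (right_mult mA) a f) (dual_rep (ad bA))
      (predual_rep scale (left_star mD)) (\<lambda>f a. - predual_rep scale (right_mult mD) f a)
      (predual_rep scale (ad bD)) \<longleftrightarrow>
    GD_algebra (module_prod.scale scale dual_scale) (UNIV \<times> dual scale)
      (double_mul scale mA mD) (double_br scale bA bD)"
  unfolding GD_matched_pair_def double_mul_def double_br_def
  using dual_actions predual_actions A.GD_algebra_axioms D.GD_algebra_axioms by blast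

lemmas predual_pairings = dual_multiplications[THEN predual_rep_pairing]

text \<open>
  The formulas for the operations of the double in which no dual representation is left: the
  invariance identities and the uniqueness lemmas compare with these.
\<close>

lemma double_mul_components:
  assumes "f \<in> dual scale" "g \<in> dual scale"
  shows "h \<in> dual scale \<Longrightarrow>
      h (fst (double_mul scale mA mD (a, f) (b, g))) = h (mA a b) - star mD f h b + mD h g a"
    and "snd (double_mul scale mA mD (a, f) (b, g)) c = mD f g c - g (star mA a c) + f (mA c b)"
  using assms
  by (simp_all add: double_mul_def dual_linear predual_pairings
      dual_rep_def left_star_def right_mult_def)

lemma double_br_components:
  assumes "f \<in> dual scale" "g \<in> dual scale"
  shows "h \<in> dual scale \<Longrightarrow>
      h (fst (double_br scale bA bD (a, f) (b, g))) = h (bA a b) - bD f h b + bD g h a"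
    and "snd (double_br scale bA bD (a, f) (b, g)) c = bD f g c - g (bA a c) + f (bA b c)"
  using assms
  by (simp_all add: double_br_def dual_linear predual_pairings
      dual_rep_def ad_def)

lemma double_mul_invariant:
  assumes "p \<in> UNIV \<times> dual scale" "q \<in> UNIV \<times> dual scale" "r \<in> UNIV \<times> dual scale"
  shows "manin_form (double_mul scale mA mD p q) r =
    - manin_form q (star (double_mul scale mA mD) p r)"
proof -
  obtain a f b g c h where "p = (a, f)" "q = (b, g)" "r = (c, h)"
    and "f \<in> dual scale" "g \<in> dual scale" "h \<in> dual scale"
    using assms by auto
  then show ?thesis
    by (simp add: manin_form_def star_def double_mul_components dual_linear)
qed

lemma double_br_invariant:
  assumes "p \<in> UNIV \<times> dual scale" "q \<in> UNIV \<times> dual scale" "r \<in> UNIV \<times> dual scale"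
  shows "manin_form (double_br scale bA bD p q) r = manin_form p (double_br scale bA bD q r)"
proof -
  obtain a f b g c h where eq: "p = (a, f)" "q = (b, g)" "r = (c, h)"
    and mem: "f \<in> dual scale" "g \<in> dual scale" "h \<in> dual scale"
    using assms by auto
  have "bA b a = - bA a b" "bA c a = - bA a c" "bD g f = - bD f g" "bD h f = - bD f h"
    by (rule A.br_antisym D.br_antisym UNIV_I mem)+
  with mem show ?thesis
    by (simp add: eq manin_form_def double_br_components dual_linear)
qed

lemma double_mul_diagonal:
  shows "double_mul scale mA mD (a, 0) (b, 0) = (mA a b, 0)"
    and "\<lbrakk>f \<in> dual scale; g \<in> dual scale\<rbrakk> \<Longrightarrow> double_mul scale mA mD (0, f) (0, g) = (0, mD f g)"
  by (intro prod_eqI ext dual_separates;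
      simp add: double_mul_components zero_in_dual dual_linear star_def D.mul_zero A.mul_zero
        linear_to_EndD(1)[OF D.mul_bilinear])+

lemma double_br_diagonal:
  shows "double_br scale bA bD (a, 0) (b, 0) = (bA a b, 0)"
    and "\<lbrakk>f \<in> dual scale; g \<in> dual scale\<rbrakk> \<Longrightarrow> double_br scale bA bD (0, f) (0, g) = (0, bD f g)"
  by (intro prod_eqI ext dual_separates;
      simp add: double_br_components zero_in_dual dual_linear D.br_zero A.br_zero
        linear_to_EndD(1)[OF D.br_bilinear])+

section \<open>Uniqueness of invariant operations\<close>

text \<open>
  Pairing with \<open>A\<^sup>*\<close> and with \<open>A\<close> reads off the two components; this is the form in which the
  nondegeneracy of the Manin form is used.
\<close>

lemma manin_form_components:
  assumes "p \<in> UNIV \<times> dual scale"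
  shows "manin_form p (0, h) = h (fst p)" and "manin_form p (u, 0) = snd p u"
  using assms by (auto simp: manin_form_def dual_zero)

lemma bilinear_split:
  assumes "linear_to_End s (UNIV \<times> dual scale) t (UNIV \<times> dual scale) \<phi>"
    and "f \<in> dual scale" "g \<in> dual scale"
  shows "\<phi> (a, f) (c, g) =
    \<phi> (a, 0) (c, 0) + \<phi> (a, 0) (0, g) + \<phi> (0, f) (c, 0) + \<phi> (0, f) (0, g)"
proof -
  note L = linear_to_EndD[OF assms(1)]
  have "\<phi> (a, f) (c, g) = \<phi> (a, 0) (c, g) + \<phi> (0, f) (c, g)"
    using L(2)[of "(a, 0)" "(0, f)" "(c, g)"] assms(2,3) zero_in_dual by simp
  also have "\<dots> = (\<phi> (a, 0) (c, 0) + \<phi> (a, 0) (0, g)) + (\<phi> (0, f) (c, 0) + \<phi> (0, f) (0, g))"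
    using L(3)[of "(a, 0)" "(c, 0)" "(0, g)"] L(3)[of "(0, f)" "(c, 0)" "(0, g)"]
      assms(2,3) zero_in_dual by simp
  finally show ?thesis
    by (simp only: add.assoc)
qed

lemma manin_triple_mul_unique:
  assumes M: "GD_Manin_triple scale mA bA mD bD m b"
    and p: "p \<in> UNIV \<times> dual scale" and q: "q \<in> UNIV \<times> dual scale"
  shows "m p q = double_mul scale mA mD p q"
proof -
  let ?V = "(UNIV :: 'a set) \<times> dual scale" and ?s = "module_prod.scale scale dual_scale"
  interpret M: GD_algebra ?s ?V m b
    using M by (simp add: GD_Manin_triple_def)
  have inv: "manin_form (m x y) z = - manin_form y (star m x z)"
    if "x \<in> ?V" "y \<in> ?V" "z \<in> ?V" for x y z
    using M that unfolding GD_Manin_triple_def by blast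
  \<comment> \<open>Commutativity of \<open>\<star>\<close> lets the left factor change places with the test vector.\<close>
  have inv': "manin_form (m x y) z = manin_form (m z y) x"
    if "x \<in> ?V" "y \<in> ?V" "z \<in> ?V" for x y z
  proof -
    have "star m x z = star m z x"
      by (simp add: star_def add.commute)
    with that show ?thesis
      by (simp add: inv)
  qed
  have AA: "m (x, 0) (y, 0) = (mA x y, 0)" for x y
    using M by (simp add: GD_Manin_triple_def)
  have DD: "m (0, f) (0, g) = (0, mD f g)" if "f \<in> dual scale" "g \<in> dual scale" for f g
    using M that by (simp add: GD_Manin_triple_def)
  obtain a f c g where pq: "p = (a, f)" "q = (c, g)"
    and f: "f \<in> dual scale" and g: "g \<in> dual scale"
    using p q by auto
  \<comment> \<open>Each mixed product is tested against \<open>A\<close> and \<open>A\<^sup>*\<close>. The two forms of invariance put either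
    both vectors of \<open>A\<close> or both of \<open>A\<^sup>*\<close> into one product, which \<open>AA\<close> or \<open>DD\<close> evaluates.\<close>
  note split = bilinear_split[OF M.mul_bilinear f g, of a c]
  have AD_mem: "m (a, 0) (0, g) \<in> ?V" and DA_mem: "m (0, f) (c, 0) \<in> ?V"
    using f g zero_in_dual by (simp_all add: linear_to_EndD(1)[OF M.mul_bilinear])
  show ?thesis
  proof (intro prod_eqI dual_separates ext)
    fix h assume h: "h \<in> dual scale"
    have "h (fst (m (a, 0) (0, g))) = mD h g a"
      using inv'[of "(a, 0)" "(0, g)" "(0, h)"] g h zero_in_dual
      by (simp add: manin_form_components(1)[OF AD_mem] DD) (simp add: manin_form_def)
    moreover have "h (fst (m (0, f) (c, 0))) = - star mD f h c"
      using inv[of "(0, f)" "(c, 0)" "(0, h)"] f h zero_in_dual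
      by (simp add: manin_form_components(1)[OF DA_mem] star_def DD) (simp add: manin_form_def)
    ultimately show "h (fst (m p q)) = h (fst (double_mul scale mA mD p q))"
      unfolding pq split double_mul_components(1)[OF f g h]
      using f g h by (simp add: AA DD dual_linear)
  next
    fix u
    have "snd (m (a, 0) (0, g)) u = - g (star mA a u)"
      using inv[of "(a, 0)" "(0, g)" "(u, 0)"] g zero_in_dual
      by (simp add: manin_form_components(2)[OF AD_mem] star_def AA) (simp add: manin_form_def)
    moreover have "snd (m (0, f) (c, 0)) u = f (mA u c)"
      using inv'[of "(0, f)" "(c, 0)" "(u, 0)"] f zero_in_dual
      by (simp add: manin_form_components(2)[OF DA_mem] AA) (simp add: manin_form_def)
    ultimately show "snd (m p q) u = snd (double_mul scale mA mD p q) u"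
      unfolding pq split double_mul_components(2)[OF f g]
      by (simp add: AA DD[OF f g])
  qed
qed

lemma manin_triple_br_unique:
  assumes M: "GD_Manin_triple scale mA bA mD bD m b"
    and p: "p \<in> UNIV \<times> dual scale" and q: "q \<in> UNIV \<times> dual scale"
  shows "b p q = double_br scale bA bD p q"
proof -
  let ?V = "(UNIV :: 'a set) \<times> dual scale" and ?s = "module_prod.scale scale dual_scale"
  interpret M: GD_algebra ?s ?V m b
    using M by (simp add: GD_Manin_triple_def)
  have inv: "manin_form (b x y) z = manin_form x (b y z)"
    if "x \<in> ?V" "y \<in> ?V" "z \<in> ?V" for x y z
    using M that unfolding GD_Manin_triple_def by blast
  have AA: "b (x, 0) (y, 0) = (bA x y, 0)" for x y
    using M by (simp add: GD_Manin_triple_def)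
  have DD: "b (0, f) (0, g) = (0, bD f g)" if "f \<in> dual scale" "g \<in> dual scale" for f g
    using M that by (simp add: GD_Manin_triple_def)
  have antisym: "b (x, 0) (0, g) = - b (0, g) (x, 0)" if "g \<in> dual scale" for x g
    using M.br_antisym[of "(0, g)" "(x, 0)"] that zero_in_dual by simp
  have mixed: "snd (b (0, g) (x, 0)) u = g (bA x u)" "h (fst (b (0, g) (x, 0))) = - bD g h x"
    if g: "g \<in> dual scale" and h: "h \<in> dual scale" for g h x u
  proof -
    have mem: "b (0, g) (x, 0) \<in> ?V" "b (x, 0) (0, g) \<in> ?V"
      using g zero_in_dual by (simp_all add: linear_to_EndD(1)[OF M.br_bilinear])
    show "snd (b (0, g) (x, 0)) u = g (bA x u)"
      using inv[of "(0, g)" "(x, 0)" "(u, 0)"] g zero_in_dual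
      by (simp add: manin_form_components(2)[OF mem(1)] AA) (simp add: manin_form_def)
    \<comment> \<open>Here \<open>x\<close> has to be the left factor, so that invariance brings \<open>g\<close> and \<open>h\<close> together.\<close>
    have "h (fst (b (x, 0) (0, g))) = bD g h x"
      using inv[of "(x, 0)" "(0, g)" "(0, h)"] g h zero_in_dual
      by (simp add: manin_form_components(1)[OF mem(2)] DD) (simp add: manin_form_def)
    from this[symmetric] show "h (fst (b (0, g) (x, 0))) = - bD g h x"
      unfolding antisym[OF g] by (simp add: dual_minus[OF h])
  qed
  obtain a f c g where pq: "p = (a, f)" "q = (c, g)"
    and f: "f \<in> dual scale" and g: "g \<in> dual scale"
    using p q by auto
  note split = bilinear_split[OF M.br_bilinear f g, of a c]
  show ?thesis
  proof (intro prod_eqI dual_separates ext)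
    fix h assume h: "h \<in> dual scale"
    show "h (fst (b p q)) = h (fst (double_br scale bA bD p q))"
      unfolding pq split antisym[OF g] double_br_components(1)[OF f g h]
      using f g h by (simp add: AA DD mixed dual_linear)
  next
    fix u
    show "snd (b p q) u = snd (double_br scale bA bD p q) u"
      unfolding pq split antisym[OF g] double_br_components(2)[OF f g]
      by (simp add: AA DD[OF f g] mixed(1)[OF f f] mixed(1)[OF g g])
  qed
qed

end

section \<open>The equivalence\<close>

theorem theorem4p8:
  fixes scale :: "'k::field_char_0 \<Rightarrow> 'a::ab_group_add \<Rightarrow> 'a"
    and Basis :: "'a set"
    and mA bA :: "'a \<Rightarrow> 'a \<Rightarrow> 'a"
    and mD bD :: "('a \<Rightarrow> 'k) \<Rightarrow> ('a \<Rightarrow> 'k) \<Rightarrow> ('a \<Rightarrow> 'k)"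
  assumes "finite_dimensional_vector_space scale Basis"
    and "GD_algebra scale UNIV mA bA"
    and "GD_algebra dual_scale (dual scale) mD bD"
  shows "(\<exists>m b. GD_Manin_triple scale mA bA mD bD m b) \<longleftrightarrow>
    GD_matched_pair
      scale UNIV mA bA
      dual_scale (dual scale) mD bD
      (dual_rep (left_star mA))
      (\<lambda>a f. - dual_rep (right_mult mA) a f)
      (dual_rep (ad bA))
      (predual_rep scale (left_star mD))
      (\<lambda>f a. - predual_rep scale (right_mult mD) f a)
      (predual_rep scale (ad bD))"
proof -
  interpret dual_GD_pair scale Basis mA bA mD bD
    using assms by (intro dual_GD_pair.intro)
  let ?V = "(UNIV :: 'a set) \<times> dual scale" and ?s = "module_prod.scale scale dual_scale"
  let ?m = "double_mul scale mA mD" and ?b = "double_br scale bA bD"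
  have "GD_algebra ?s ?V ?m ?b" if M: "GD_Manin_triple scale mA bA mD bD m b" for m b
  proof (rule GD_algebra_cong)
    show "GD_algebra ?s ?V m b"
      using M by (simp add: GD_Manin_triple_def)
  qed (simp_all only: manin_triple_mul_unique[OF M] manin_triple_br_unique[OF M])
  moreover have "GD_Manin_triple scale mA bA mD bD ?m ?b" if "GD_algebra ?s ?V ?m ?b"
    unfolding GD_Manin_triple_def
    by (intro conjI allI ballI that assms(2,3) double_mul_diagonal double_br_diagonal
        double_mul_invariant double_br_invariant)
  ultimately show ?thesis
    unfolding matched_pair_iff by blast
qed

end
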